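(* Let $Q$ be a commutative RIF loop. Then: (i) for each $x\in Q$, $x^2\in M_0(Q)$; (ii) $M_0(Q)$ is a normal subloop of $Q$; (iii) $Q/M_0(Q)$ is a C loop of exponent $2$, i.e., a Steiner loop.
   Context: A loop is a set $Q$ with a binary operation with neutral element $1$ such that for all $a,b\in Q$ the equations $ax=b$ and $ya=b$ have unique solutions $x,y\in Q$. A loop is an inverse property (IP) loop if each $x$ has a (two-sided) inverse $x^{-1}$ with $x^{-1}(xy)=y$ and $(yx)x^{-1}=y$ for all $y$. A RIF loop is an IP loop satisfying either, and hence both, of the (equivalent) identities $((xy)z)(xy)=x(y((zx)y))$ and $(xy)(z(xy))=((x(yz))x)y$. It is known that RIF loops are diassociative, i.e., any two elements generate a subgroup; so powers are well defined. $M_0(Q)$, the set of Moufang elements of $Q$, is the set of all $c\in Q$ such that $(c(xy))c=(cx)(yc)$ for all $x,y\in Q$. A subloop is normal if it is the kernel of some loop homomorphism defined on $Q$. A C loop is a loop satisfying $x(y(yz))=((xy)y)z$. A loop has exponent $n$ if $x^n=1$ for all its elements $x$. A Steiner loop is an IP loop of exponent $2$, or equivalently, a C loop of exponent $2$. *)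

theory Defs
  imports "HOL-Algebra.Coset"
begin

text \<open>
  Loops live on the \<open>monoid\<close> record of HOL-Algebra, used here only as a carrier with a
  binary operation and a constant; associativity is not assumed. The notions \<open>hom\<close>,
  \<open>kernel\<close>, \<open>#>\<close>, \<open><#>\<close>, \<open>Mod\<close> and \<open>[^]\<close> of HOL-Algebra make sense for
  every such record.
\<close>

locale loop =
  fixes Q (structure)
  assumes mult_closed: "\<lbrakk>x \<in> carrier Q; y \<in> carrier Q\<rbrakk> \<Longrightarrow> x \<otimes> y \<in> carrier Q"
    and one_closed: "\<one> \<in> carrier Q"
    and one_left: "x \<in> carrier Q \<Longrightarrow> \<one> \<otimes> x = x"
    and one_right: "x \<in> carrier Q \<Longrightarrow> x \<otimes> \<one> = x"
    and left_division:
      "\<lbrakk>a \<in> carrier Q; b \<in> carrier Q\<rbrakk> \<Longrightarrow> \<exists>!x. x \<in> carrier Q \<and> a \<otimes> x = b"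
    and right_division:
      "\<lbrakk>a \<in> carrier Q; b \<in> carrier Q\<rbrakk> \<Longrightarrow> \<exists>!y. y \<in> carrier Q \<and> y \<otimes> a = b"

locale ip_loop = loop +
  assumes inverse_property:
    "x \<in> carrier Q \<Longrightarrow> \<exists>x' \<in> carrier Q. x \<otimes> x' = \<one> \<and> x' \<otimes> x = \<one> \<and>
       (\<forall>y \<in> carrier Q. x' \<otimes> (x \<otimes> y) = y \<and> (y \<otimes> x) \<otimes> x' = y)"

text \<open>
  The two alternatives below are equivalent in IP loops: applying inverses to one of them
  gives the other.
\<close>

locale rif_loop = ip_loop +
  assumes rif:
    "(\<forall>x \<in> carrier Q. \<forall>y \<in> carrier Q. \<forall>z \<in> carrier Q.
        ((x \<otimes> y) \<otimes> z) \<otimes> (x \<otimes> y) = x \<otimes> (y \<otimes> ((z \<otimes> x) \<otimes> y))) \<or>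
     (\<forall>x \<in> carrier Q. \<forall>y \<in> carrier Q. \<forall>z \<in> carrier Q.
        (x \<otimes> y) \<otimes> (z \<otimes> (x \<otimes> y)) = ((x \<otimes> (y \<otimes> z)) \<otimes> x) \<otimes> y)"

locale comm_rif_loop = rif_loop +
  assumes commutative: "\<lbrakk>x \<in> carrier Q; y \<in> carrier Q\<rbrakk> \<Longrightarrow> x \<otimes> y = y \<otimes> x"

locale c_loop = loop +
  assumes c_identity:
    "\<lbrakk>x \<in> carrier Q; y \<in> carrier Q; z \<in> carrier Q\<rbrakk>
      \<Longrightarrow> x \<otimes> (y \<otimes> (y \<otimes> z)) = ((x \<otimes> y) \<otimes> y) \<otimes> z"

definition has_exponent :: "('a, 'b) monoid_scheme \<Rightarrow> nat \<Rightarrow> bool" where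
  "has_exponent Q n \<longleftrightarrow> (\<forall>x \<in> carrier Q. x [^]\<^bsub>Q\<^esub> n = \<one>\<^bsub>Q\<^esub>)"

definition steiner_loop :: "('a, 'b) monoid_scheme \<Rightarrow> bool" where
  "steiner_loop Q \<longleftrightarrow> ip_loop Q \<and> has_exponent Q 2"

definition moufang_elements :: "('a, 'b) monoid_scheme \<Rightarrow> 'a set" (\<open>M\<^sub>0\<close>) where
  "M\<^sub>0 Q = {c \<in> carrier Q. \<forall>x \<in> carrier Q. \<forall>y \<in> carrier Q.
     (c \<otimes>\<^bsub>Q\<^esub> (x \<otimes>\<^bsub>Q\<^esub> y)) \<otimes>\<^bsub>Q\<^esub> c = (c \<otimes>\<^bsub>Q\<^esub> x) \<otimes>\<^bsub>Q\<^esub> (y \<otimes>\<^bsub>Q\<^esub> c)}"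

definition subloop :: "'a set \<Rightarrow> ('a, 'b) monoid_scheme \<Rightarrow> bool" where
  "subloop N Q \<longleftrightarrow> N \<subseteq> carrier Q \<and> loop (Q\<lparr>carrier := N\<rparr>)"

text \<open>
  HOL cannot quantify over the element type of the codomain, so it is fixed to \<open>'a set\<close>.
  This loses no generality: by \<open>normal_subloop_kernel\<close> below, kernels of homomorphisms
  into loops over any type are normal in this sense.
\<close>

definition normal_subloop :: "'a set \<Rightarrow> ('a, 'b) monoid_scheme \<Rightarrow> bool" where
  "normal_subloop N Q \<longleftrightarrow> subloop N Q \<and>
     (\<exists>(H :: 'a set monoid) f. loop H \<and> f \<in> hom Q H \<and> N = kernel Q H f)"

lemma loop_hom_one:
  assumes "loop Q" "loop H" "f \<in> hom Q H"
  shows "f \<one>\<^bsub>Q\<^esub> = \<one>\<^bsub>H\<^esub>"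
proof -
  interpret Q: loop Q by fact
  interpret H: loop H by fact
  have c: "f \<one>\<^bsub>Q\<^esub> \<in> carrier H"
    using assms(3) Q.one_closed by (auto simp: hom_def)
  have "f \<one>\<^bsub>Q\<^esub> \<otimes>\<^bsub>H\<^esub> f \<one>\<^bsub>Q\<^esub> = f (\<one>\<^bsub>Q\<^esub> \<otimes>\<^bsub>Q\<^esub> \<one>\<^bsub>Q\<^esub>)"
    using assms(3) Q.one_closed by (simp add: hom_def)
  also have "\<dots> = f \<one>\<^bsub>Q\<^esub>" by (simp add: Q.one_left Q.one_closed)
  finally show ?thesis
    using H.left_division[OF c c] H.one_right[OF c] c H.one_closed by blast
qed

lemma loop_kernel_r_coset:
  assumes "loop Q" "loop H" "f \<in> hom Q H" "a \<in> carrier Q"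
  shows "kernel Q H f #>\<^bsub>Q\<^esub> a = {x \<in> carrier Q. f x = f a}"
proof -
  interpret Q: loop Q by fact
  interpret H: loop H by fact
  have hc: "\<And>x. x \<in> carrier Q \<Longrightarrow> f x \<in> carrier H"
    and hm: "\<And>x y. \<lbrakk>x \<in> carrier Q; y \<in> carrier Q\<rbrakk> \<Longrightarrow> f (x \<otimes>\<^bsub>Q\<^esub> y) = f x \<otimes>\<^bsub>H\<^esub> f y"
    using assms(3) by (auto simp: hom_def)
  show ?thesis
  proof (intro equalityI subsetI)
    fix x assume "x \<in> kernel Q H f #>\<^bsub>Q\<^esub> a"
    then show "x \<in> {x \<in> carrier Q. f x = f a}"
      using assms(4) by (auto simp: r_coset_def kernel_def hm hc H.one_left Q.mult_closed)
  next
    fix x assume "x \<in> {x \<in> carrier Q. f x = f a}"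
    then have x: "x \<in> carrier Q" "f x = f a" by auto
    obtain y where y: "y \<in> carrier Q" "y \<otimes>\<^bsub>Q\<^esub> a = x"
      using Q.right_division[OF assms(4) x(1)] by blast
    have "f y \<otimes>\<^bsub>H\<^esub> f a = f a" using hm[OF y(1) assms(4)] y x by simp
    then have "f y = \<one>\<^bsub>H\<^esub>"
      using H.right_division[OF hc[OF assms(4)] hc[OF assms(4)]] hc y(1) H.one_closed
        H.one_left[OF hc[OF assms(4)]] by blast
    then show "x \<in> kernel Q H f #>\<^bsub>Q\<^esub> a"
      using y by (auto simp: r_coset_def kernel_def)
  qed
qed

lemma loop_kernel_set_mult:
  assumes "loop Q" "loop H" "f \<in> hom Q H" "a \<in> carrier Q" "b \<in> carrier Q"
  shows "(kernel Q H f #>\<^bsub>Q\<^esub> a) <#>\<^bsub>Q\<^esub> (kernel Q H f #>\<^bsub>Q\<^esub> b)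
    = kernel Q H f #>\<^bsub>Q\<^esub> (a \<otimes>\<^bsub>Q\<^esub> b)"
proof -
  interpret Q: loop Q by fact
  interpret H: loop H by fact
  have hc: "\<And>x. x \<in> carrier Q \<Longrightarrow> f x \<in> carrier H"
    and hm: "\<And>x y. \<lbrakk>x \<in> carrier Q; y \<in> carrier Q\<rbrakk> \<Longrightarrow> f (x \<otimes>\<^bsub>Q\<^esub> y) = f x \<otimes>\<^bsub>H\<^esub> f y"
    using assms(3) by (auto simp: hom_def)
  have ab: "a \<otimes>\<^bsub>Q\<^esub> b \<in> carrier Q" using assms Q.mult_closed by auto
  note co = loop_kernel_r_coset[OF assms(1-3)]
  show ?thesis
    unfolding co[OF assms(4)] co[OF assms(5)] co[OF ab]
  proof (intro equalityI subsetI)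
    fix z assume "z \<in> {x \<in> carrier Q. f x = f a} <#>\<^bsub>Q\<^esub> {x \<in> carrier Q. f x = f b}"
    then show "z \<in> {x \<in> carrier Q. f x = f (a \<otimes>\<^bsub>Q\<^esub> b)}"
      using assms(4,5) by (auto simp: set_mult_def hm Q.mult_closed)
  next
    fix z assume "z \<in> {x \<in> carrier Q. f x = f (a \<otimes>\<^bsub>Q\<^esub> b)}"
    then have z: "z \<in> carrier Q" "f z = f a \<otimes>\<^bsub>H\<^esub> f b" using hm assms by auto
    obtain y where y: "y \<in> carrier Q" "a \<otimes>\<^bsub>Q\<^esub> y = z"
      using Q.left_division[OF assms(4) z(1)] by blast
    have "f a \<otimes>\<^bsub>H\<^esub> f y = f a \<otimes>\<^bsub>H\<^esub> f b" using hm[OF assms(4) y(1)] y z by simp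
    then have "f y = f b"
      using H.left_division[OF hc[OF assms(4)] H.mult_closed[OF hc[OF assms(4)] hc[OF assms(5)]]]
        hc y(1) assms(5) by blast
    then show "z \<in> {x \<in> carrier Q. f x = f a} <#>\<^bsub>Q\<^esub> {x \<in> carrier Q. f x = f b}"
      using y assms(4) by (auto simp: set_mult_def)
  qed
qed

lemma loop_Mod_kernel:
  assumes "loop Q" "loop H" "f \<in> hom Q H"
  shows "loop (Q Mod kernel Q H f)"
proof -
  interpret Q: loop Q by fact
  interpret H: loop H by fact
  let ?N = "kernel Q H f"
  note co = loop_kernel_r_coset[OF assms]
  note mu = loop_kernel_set_mult[OF assms]
  have hc: "\<And>x. x \<in> carrier Q \<Longrightarrow> f x \<in> carrier H"
    and hm: "\<And>x y. \<lbrakk>x \<in> carrier Q; y \<in> carrier Q\<rbrakk> \<Longrightarrow> f (x \<otimes>\<^bsub>Q\<^esub> y) = f x \<otimes>\<^bsub>H\<^esub> f y"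
    using assms(3) by (auto simp: hom_def)
  have eq: "?N #>\<^bsub>Q\<^esub> a = ?N #>\<^bsub>Q\<^esub> b \<longleftrightarrow> f a = f b" if "a \<in> carrier Q" "b \<in> carrier Q" for a b
    using that by (auto simp: co)
  have N: "?N = ?N #>\<^bsub>Q\<^esub> \<one>\<^bsub>Q\<^esub>"
    unfolding co[OF Q.one_closed] loop_hom_one[OF assms] by (simp add: kernel_def)
  have rep: "\<exists>a \<in> carrier Q. A = ?N #>\<^bsub>Q\<^esub> a" if "A \<in> rcosets\<^bsub>Q\<^esub> ?N" for A
    using that by (auto simp: RCOSETS_def)
  have mem: "?N #>\<^bsub>Q\<^esub> a \<in> rcosets\<^bsub>Q\<^esub> ?N" if "a \<in> carrier Q" for a
    using that by (auto simp: RCOSETS_def)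
  have l: "\<exists>!X. X \<in> rcosets\<^bsub>Q\<^esub> ?N \<and> A <#>\<^bsub>Q\<^esub> X = B"
    and r: "\<exists>!X. X \<in> rcosets\<^bsub>Q\<^esub> ?N \<and> X <#>\<^bsub>Q\<^esub> A = B"
    if AB: "A \<in> rcosets\<^bsub>Q\<^esub> ?N" "B \<in> rcosets\<^bsub>Q\<^esub> ?N" for A B
  proof -
    obtain a b where ab: "a \<in> carrier Q" "b \<in> carrier Q" "A = ?N #>\<^bsub>Q\<^esub> a" "B = ?N #>\<^bsub>Q\<^esub> b"
      using rep AB by metis
    obtain x where x: "x \<in> carrier Q" "a \<otimes>\<^bsub>Q\<^esub> x = b"
      using Q.left_division[OF ab(1,2)] by blast
    obtain y where y: "y \<in> carrier Q" "y \<otimes>\<^bsub>Q\<^esub> a = b"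
      using Q.right_division[OF ab(1,2)] by blast
    show "\<exists>!X. X \<in> rcosets\<^bsub>Q\<^esub> ?N \<and> A <#>\<^bsub>Q\<^esub> X = B"
    proof (rule ex1I)
      show "?N #>\<^bsub>Q\<^esub> x \<in> rcosets\<^bsub>Q\<^esub> ?N \<and> A <#>\<^bsub>Q\<^esub> (?N #>\<^bsub>Q\<^esub> x) = B"
        using x ab mu mem by simp
    next
      fix X assume X: "X \<in> rcosets\<^bsub>Q\<^esub> ?N \<and> A <#>\<^bsub>Q\<^esub> X = B"
      then obtain c where c: "c \<in> carrier Q" "X = ?N #>\<^bsub>Q\<^esub> c" using rep by blast
      have "?N #>\<^bsub>Q\<^esub> (a \<otimes>\<^bsub>Q\<^esub> c) = ?N #>\<^bsub>Q\<^esub> (a \<otimes>\<^bsub>Q\<^esub> x)" using X c ab x mu by simp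
      then have e: "f a \<otimes>\<^bsub>H\<^esub> f c = f a \<otimes>\<^bsub>H\<^esub> f x"
        using eq[of "a \<otimes>\<^bsub>Q\<^esub> c" "a \<otimes>\<^bsub>Q\<^esub> x"] ab(1) c(1) x(1) by (simp add: Q.mult_closed hm)
      have "f c = f x"
        using H.left_division[OF hc[OF ab(1)] H.mult_closed[OF hc[OF ab(1)] hc[OF x(1)]]]
          hc[OF c(1)] hc[OF x(1)] e by blast
      then show "X = ?N #>\<^bsub>Q\<^esub> x" using eq c x by simp
    qed
    show "\<exists>!X. X \<in> rcosets\<^bsub>Q\<^esub> ?N \<and> X <#>\<^bsub>Q\<^esub> A = B"
    proof (rule ex1I)
      show "?N #>\<^bsub>Q\<^esub> y \<in> rcosets\<^bsub>Q\<^esub> ?N \<and> (?N #>\<^bsub>Q\<^esub> y) <#>\<^bsub>Q\<^esub> A = B"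
        using y ab mu mem by simp
    next
      fix X assume X: "X \<in> rcosets\<^bsub>Q\<^esub> ?N \<and> X <#>\<^bsub>Q\<^esub> A = B"
      then obtain c where c: "c \<in> carrier Q" "X = ?N #>\<^bsub>Q\<^esub> c" using rep by blast
      have "?N #>\<^bsub>Q\<^esub> (c \<otimes>\<^bsub>Q\<^esub> a) = ?N #>\<^bsub>Q\<^esub> (y \<otimes>\<^bsub>Q\<^esub> a)" using X c ab y mu by simp
      then have e: "f c \<otimes>\<^bsub>H\<^esub> f a = f y \<otimes>\<^bsub>H\<^esub> f a"
        using eq[of "c \<otimes>\<^bsub>Q\<^esub> a" "y \<otimes>\<^bsub>Q\<^esub> a"] ab(1) c(1) y(1) by (simp add: Q.mult_closed hm)
      have "f c = f y"
        using H.right_division[OF hc[OF ab(1)] H.mult_closed[OF hc[OF y(1)] hc[OF ab(1)]]]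
          hc[OF c(1)] hc[OF y(1)] e by blast
      then show "X = ?N #>\<^bsub>Q\<^esub> y" using eq c y by simp
    qed
  qed
  show ?thesis
  proof (unfold_locales, unfold FactGroup_def, simp_all only: partial_object.simps monoid.simps)
    fix A B assume "A \<in> rcosets\<^bsub>Q\<^esub> ?N" "B \<in> rcosets\<^bsub>Q\<^esub> ?N"
    then show "A <#>\<^bsub>Q\<^esub> B \<in> rcosets\<^bsub>Q\<^esub> ?N" using rep mu mem Q.mult_closed by metis
  next
    show "?N \<in> rcosets\<^bsub>Q\<^esub> ?N" using N[symmetric] mem[OF Q.one_closed] by simp
  next
    fix A assume "A \<in> rcosets\<^bsub>Q\<^esub> ?N"
    then obtain a where a: "a \<in> carrier Q" "A = ?N #>\<^bsub>Q\<^esub> a" using rep by blast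
    show "?N <#>\<^bsub>Q\<^esub> A = A" using mu[OF Q.one_closed a(1)] N[symmetric] a Q.one_left by simp
    show "A <#>\<^bsub>Q\<^esub> ?N = A" using mu[OF a(1) Q.one_closed] N[symmetric] a Q.one_right by simp
  next
    fix A B assume "A \<in> rcosets\<^bsub>Q\<^esub> ?N" "B \<in> rcosets\<^bsub>Q\<^esub> ?N"
    then show "\<exists>!X. X \<in> rcosets\<^bsub>Q\<^esub> ?N \<and> A <#>\<^bsub>Q\<^esub> X = B"
      and "\<exists>!X. X \<in> rcosets\<^bsub>Q\<^esub> ?N \<and> X <#>\<^bsub>Q\<^esub> A = B" by (fact l, fact r)
  qed
qed

lemma subloop_kernel:
  assumes "loop Q" "loop H" "f \<in> hom Q H"
  shows "subloop (kernel Q H f) Q"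
proof -
  interpret Q: loop Q by fact
  interpret H: loop H by fact
  have hc: "\<And>x. x \<in> carrier Q \<Longrightarrow> f x \<in> carrier H"
    and hm: "\<And>x y. \<lbrakk>x \<in> carrier Q; y \<in> carrier Q\<rbrakk> \<Longrightarrow> f (x \<otimes>\<^bsub>Q\<^esub> y) = f x \<otimes>\<^bsub>H\<^esub> f y"
    using assms(3) by (auto simp: hom_def)
  have l: "f x = \<one>\<^bsub>H\<^esub>" if "x \<in> carrier Q" "f a = \<one>\<^bsub>H\<^esub>" "a \<in> carrier Q"
      "f (a \<otimes>\<^bsub>Q\<^esub> x) = \<one>\<^bsub>H\<^esub>" for a x
    using that hm[of a x] hc H.one_left by simp
  have r: "f x = \<one>\<^bsub>H\<^esub>" if "x \<in> carrier Q" "f a = \<one>\<^bsub>H\<^esub>" "a \<in> carrier Q"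
      "f (x \<otimes>\<^bsub>Q\<^esub> a) = \<one>\<^bsub>H\<^esub>" for a x
    using that hm[of x a] hc H.one_right by simp
  have "loop (Q\<lparr>carrier := kernel Q H f\<rparr>)"
  proof (unfold_locales, simp_all add: kernel_def Q.mult_closed hm Q.one_left Q.one_right
      Q.one_closed H.one_left H.one_closed loop_hom_one[OF assms])
    fix a b assume "a \<in> carrier Q \<and> f a = \<one>\<^bsub>H\<^esub>" "b \<in> carrier Q \<and> f b = \<one>\<^bsub>H\<^esub>"
    then show "\<exists>!x. x \<in> carrier Q \<and> f x = \<one>\<^bsub>H\<^esub> \<and> a \<otimes>\<^bsub>Q\<^esub> x = b"
      and "\<exists>!y. y \<in> carrier Q \<and> f y = \<one>\<^bsub>H\<^esub> \<and> y \<otimes>\<^bsub>Q\<^esub> a = b"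
      by (metis Q.left_division l, metis Q.right_division r)
  qed
  then show ?thesis by (auto simp: subloop_def kernel_def)
qed

lemma normal_subloop_kernel:
  fixes Q :: "('a, 'b) monoid_scheme" and H :: "('c, 'd) monoid_scheme"
  assumes "loop Q" "loop H" "f \<in> hom Q H"
  shows "normal_subloop (kernel Q H f) Q"
proof -
  interpret Q: loop Q by fact
  let ?N = "kernel Q H f"
  let ?g = "\<lambda>a. ?N #>\<^bsub>Q\<^esub> a"
  have h: "?g \<in> hom Q (Q Mod ?N)"
    using loop_kernel_set_mult[OF assms] by (auto simp: hom_def FactGroup_def RCOSETS_def)
  have N: "?N = {x \<in> carrier Q. f x = f \<one>\<^bsub>Q\<^esub>}"
    using loop_hom_one[OF assms] by (simp add: kernel_def)
  have k: "kernel Q (Q Mod ?N) ?g = ?N"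
  proof -
    have "?g a = ?N \<longleftrightarrow> a \<in> ?N" if "a \<in> carrier Q" for a
      using loop_kernel_r_coset[OF assms that] N that Q.one_closed by auto
    moreover have "?N \<subseteq> carrier Q" by (auto simp: kernel_def)
    moreover have "\<one>\<^bsub>Q Mod ?N\<^esub> = ?N" by (simp add: FactGroup_def)
    ultimately show ?thesis unfolding kernel_def[of Q "Q Mod ?N"] by auto
  qed
  have "?N = kernel Q (Q Mod ?N) ?g" using k by simp
  then show ?thesis
    unfolding normal_subloop_def
    using subloop_kernel[OF assms] loop_Mod_kernel[OF assms] h by blast
qed

end

theory Submission
  imports Defs
begin

text \<open>
  Write \<open>L(x)\<close> for the translation by \<open>x\<close>. In the commutative case the RIF identity says
  \<open>L(xy)\<^sup>2 = L(x) L(y)\<^sup>2 L(x)\<close>. It yields the alternative law and the ARIF identity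
  \<open>x((y(yx))z) = (x(xy))(yz)\<close>. Putting \<open>x = a\<^sup>2\<close> in the latter gives
  \<open>L(s(sy)) = L(s) L(y) L(s)\<close> for \<open>s = a\<^sup>2\<close>, which in a commutative IP loop is equivalent to
  \<open>s\<close> being a Moufang element.

  For normality it is enough to write \<open>x(cy)\<close> as \<open>c'(xy)\<close> with \<open>c'\<close> Moufang whenever \<open>c\<close> is.
  The cube of a Moufang element \<open>c\<close> is nuclear, so by \<open>c = c\<^sup>3 (c\<inverse>)\<^sup>2\<close> only squares have
  to be treated; and \<open>x(r\<^sup>2y) = t\<^sup>2(xy)\<close> for \<open>t = (xy)\<inverse>(x(yr))\<close>.
\<close>

section \<open>Two-sided inverses in IP loops\<close>

context ip_loop
begin

text \<open>\<open>inv\<close> is a definite description of a two-sided inverse, so unique existence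
  gives it its meaning; uniqueness is unique left division of \<open>\<one>\<close> by
  \<open>x\<close>.\<close>

lemma inv_ex1:
  assumes "x \<in> carrier Q"
  shows "\<exists>!x'. x' \<in> carrier Q \<and> x \<otimes> x' = \<one> \<and> x' \<otimes> x = \<one>"
  using inverse_property[OF assms] left_division[OF assms one_closed] by metis

lemma inv_props:
  assumes "x \<in> carrier Q"
  shows inv_closed: "inv x \<in> carrier Q"
    and right_inv: "x \<otimes> inv x = \<one>"
    and left_inv: "inv x \<otimes> x = \<one>"
  using theI'[OF inv_ex1[OF assms]] by (simp_all add: m_inv_def)

lemma inv_cancel:
  assumes "x \<in> carrier Q" "y \<in> carrier Q"
  shows inv_cancel_left: "inv x \<otimes> (x \<otimes> y) = y"
    and inv_cancel_right: "(y \<otimes> x) \<otimes> inv x = y"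
proof -
  obtain x' where x': "x' \<in> carrier Q" "x \<otimes> x' = \<one>" "x' \<otimes> x = \<one>"
    and *: "\<forall>y \<in> carrier Q. x' \<otimes> (x \<otimes> y) = y \<and> (y \<otimes> x) \<otimes> x' = y"
    using inverse_property[OF assms(1)] by blast
  \<comment> \<open>The witness of the inverse property is in particular a two-sided inverse, hence
    it is the described one.\<close>
  have "inv x = x'"
    using inv_ex1[OF assms(1)] inv_props[OF assms(1)] x' by blast
  then show "inv x \<otimes> (x \<otimes> y) = y" "(y \<otimes> x) \<otimes> inv x = y"
    using * assms(2) by auto
qed

lemma inv_inv:
  assumes "x \<in> carrier Q"
  shows "inv (inv x) = x"
  using inv_ex1[OF inv_closed[OF assms]] inv_props[OF assms] inv_props[OF inv_closed[OF assms]] assms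
  by metis

lemma inv_cancel_left':
  assumes "x \<in> carrier Q" "y \<in> carrier Q"
  shows "x \<otimes> (inv x \<otimes> y) = y"
  using inv_cancel_left[OF inv_closed[OF assms(1)] assms(2)] inv_inv[OF assms(1)] by simp

end

section \<open>Basic identities of commutative RIF loops\<close>

context comm_rif_loop
begin

lemmas closed [simp] = mult_closed one_closed inv_closed
lemmas cancel [simp] = one_left one_right right_inv left_inv inv_inv
  inv_cancel_left inv_cancel_right inv_cancel_left'

text \<open>Under commutativity both forms of the RIF identity collapse to
  \<open>L(xy)^2 = L(x) L(y)^2 L(x)\<close>, which all later arguments use.\<close>

lemma rif_left:
  assumes [simp]: "x \<in> carrier Q" "y \<in> carrier Q" "z \<in> carrier Q"
  shows "(x \<otimes> y) \<otimes> ((x \<otimes> y) \<otimes> z) = x \<otimes> (y \<otimes> (y \<otimes> (x \<otimes> z)))"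
  using rif
proof
  assume *: "\<forall>x \<in> carrier Q. \<forall>y \<in> carrier Q. \<forall>z \<in> carrier Q.
    ((x \<otimes> y) \<otimes> z) \<otimes> (x \<otimes> y) = x \<otimes> (y \<otimes> ((z \<otimes> x) \<otimes> y))"
  have "((x \<otimes> y) \<otimes> z) \<otimes> (x \<otimes> y) = x \<otimes> (y \<otimes> ((z \<otimes> x) \<otimes> y))" using * by simp
  then show ?thesis
    by (simp add: commutative[of "(x \<otimes> y) \<otimes> z"] commutative[of z x]
      commutative[of "x \<otimes> z" y])
next
  assume *: "\<forall>x \<in> carrier Q. \<forall>y \<in> carrier Q. \<forall>z \<in> carrier Q.
    (x \<otimes> y) \<otimes> (z \<otimes> (x \<otimes> y)) = ((x \<otimes> (y \<otimes> z)) \<otimes> x) \<otimes> y"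
  \<comment> \<open>The variables are exchanged because the second form ends in its second factor,
    which commutativity turns into the outermost translation.\<close>
  have "(y \<otimes> x) \<otimes> (z \<otimes> (y \<otimes> x)) = ((y \<otimes> (x \<otimes> z)) \<otimes> y) \<otimes> x" using * by simp
  then show ?thesis
    by (simp add: commutative[of z "x \<otimes> y"] commutative[of y x]
      commutative[of "y \<otimes> (y \<otimes> (x \<otimes> z))" x] commutative[of "y \<otimes> (x \<otimes> z)" y])
qed

text \<open>\<open>L(xy)^2\<close> is symmetric in \<open>x\<close> and \<open>y\<close>, so its two
  factorizations agree.\<close>

lemma rif_left_swap:
  assumes "x \<in> carrier Q" "y \<in> carrier Q" "z \<in> carrier Q"
  shows "x \<otimes> (y \<otimes> (y \<otimes> (x \<otimes> z))) = y \<otimes> (x \<otimes> (x \<otimes> (y \<otimes> z)))"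
  using rif_left[OF assms] rif_left[OF assms(2,1,3)] commutative[OF assms(1,2)] by simp

lemma alternative:
  assumes [simp]: "x \<in> carrier Q" "y \<in> carrier Q"
  shows "(x \<otimes> x) \<otimes> y = x \<otimes> (x \<otimes> y)"
proof -
  have u: "inv y \<otimes> (x \<otimes> x) = x \<otimes> (inv y \<otimes> x)"
    if [simp]: "x \<in> carrier Q" "y \<in> carrier Q" for x y
  proof -
    \<comment> \<open>Factoring \<open>x = yv\<close> lets the RIF identity at
      \<open>z = \<one>\<close> expand \<open>x \<otimes> x\<close> with \<open>y\<close> outermost,
      where \<open>inv y\<close> cancels it.\<close>
    define v where "v = inv y \<otimes> x"
    have [simp]: "v \<in> carrier Q" and yv: "y \<otimes> v = x" by (simp_all add: v_def)
    have "x \<otimes> x = y \<otimes> (v \<otimes> (v \<otimes> y))" using rif_left[of y v \<one>] yv by simp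
    then have "inv y \<otimes> (x \<otimes> x) = v \<otimes> (v \<otimes> y)" by simp
    also have "\<dots> = x \<otimes> v" using yv by (simp add: commutative[of v])
    finally show ?thesis by (simp add: v_def)
  qed
  have "y \<otimes> (x \<otimes> x) = x \<otimes> (y \<otimes> x)" using u[of x "inv y"] by simp
  then show ?thesis by (simp add: commutative[of "x \<otimes> x" y] commutative[of x y])
qed

lemma square_mult:
  assumes [simp]: "x \<in> carrier Q" "y \<in> carrier Q"
  shows "(x \<otimes> y) \<otimes> (x \<otimes> y) = (x \<otimes> x) \<otimes> (y \<otimes> y)"
  using rif_left[of x y \<one>]
  by (simp add: alternative commutative[of x "y \<otimes> y"])

text \<open>This is \<open>L(xr)^2 = L(x) L(r)^2 L(x)\<close> applied to
  \<open>inv x \<otimes> w\<close>, so that the innermost \<open>L(x)\<close> cancels. It is the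
  main device for moving squares across a product.\<close>

lemma square_mult_left:
  assumes [simp]: "x \<in> carrier Q" "r \<in> carrier Q" "w \<in> carrier Q"
  shows "((x \<otimes> x) \<otimes> (r \<otimes> r)) \<otimes> (inv x \<otimes> w) = x \<otimes> ((r \<otimes> r) \<otimes> w)"
proof -
  have "((x \<otimes> x) \<otimes> (r \<otimes> r)) \<otimes> (inv x \<otimes> w) = (x \<otimes> r) \<otimes> ((x \<otimes> r) \<otimes> (inv x \<otimes> w))"
    using alternative[of "x \<otimes> r" "inv x \<otimes> w"] by (simp add: square_mult[of x r])
  also have "\<dots> = x \<otimes> ((r \<otimes> r) \<otimes> w)" by (simp add: rif_left alternative)
  finally show ?thesis .
qed

lemma arif:
  assumes [simp]: "x \<in> carrier Q" "y \<in> carrier Q" "z \<in> carrier Q"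
  shows "x \<otimes> ((y \<otimes> (y \<otimes> x)) \<otimes> z) = (x \<otimes> (x \<otimes> y)) \<otimes> (y \<otimes> z)"
proof -
  \<comment> \<open>The swap law is used at \<open>x\<close>, \<open>w\<close>,
    \<open>inv z\<close>: there \<open>w \<otimes> inv z\<close> is \<open>y\<close>, and
    \<open>L(w)^2 = L(z) L(y)^2 L(z)\<close> sends \<open>x \<otimes> inv z\<close> to
    \<open>z(y(yx))\<close>.\<close>
  define w where "w = z \<otimes> y"
  have [simp]: "w \<in> carrier Q" by (simp add: w_def)
  have wz: "w \<otimes> inv z = y"
    by (simp add: w_def commutative[of z y])
  have "w \<otimes> (x \<otimes> (x \<otimes> y)) = w \<otimes> (x \<otimes> (x \<otimes> (w \<otimes> inv z)))"
    by (simp add: wz)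
  also have "\<dots> = x \<otimes> (w \<otimes> (w \<otimes> (x \<otimes> inv z)))" by (rule rif_left_swap) simp_all
  also have "w \<otimes> (w \<otimes> (x \<otimes> inv z)) = z \<otimes> (y \<otimes> (y \<otimes> x))"
    by (simp add: w_def rif_left commutative[of x "inv z"])
  finally show ?thesis
    by (simp add: w_def commutative[of z] commutative[of "y \<otimes> z"])
qed

lemma inv_mult:
  assumes [simp]: "x \<in> carrier Q" "y \<in> carrier Q"
  shows "inv (x \<otimes> y) = inv x \<otimes> inv y"
proof -
  have "y \<otimes> inv (x \<otimes> y) = inv x"
    using inv_cancel_right[of "x \<otimes> y" "inv x"] by simp
  then have "inv (x \<otimes> y) = inv y \<otimes> inv x"
    using inv_cancel_left[of y "inv (x \<otimes> y)"] by simp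
  then show ?thesis by (simp add: commutative[of "inv y"])
qed

section \<open>Moufang elements and their Bol form\<close>

lemma moufang_iff:
  "c \<in> M\<^sub>0 Q \<longleftrightarrow> c \<in> carrier Q \<and>
    (\<forall>x \<in> carrier Q. \<forall>y \<in> carrier Q. c \<otimes> (c \<otimes> (x \<otimes> y)) = (c \<otimes> x) \<otimes> (c \<otimes> y))"
  unfolding moufang_elements_def mem_Collect_eq
  by (intro conj_cong refl ball_cong) (simp add: commutative[of _ c])

lemma moufang_closed [simp]: "c \<in> M\<^sub>0 Q \<Longrightarrow> c \<in> carrier Q"
  by (simp add: moufang_elements_def)

lemma moufang:
  "\<lbrakk>c \<in> M\<^sub>0 Q; x \<in> carrier Q; y \<in> carrier Q\<rbrakk>
    \<Longrightarrow> c \<otimes> (c \<otimes> (x \<otimes> y)) = (c \<otimes> x) \<otimes> (c \<otimes> y)"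
  unfolding moufang_iff by blast

text \<open>At the arguments \<open>xy\<close> and \<open>inv (c \<otimes> x)\<close> the right-hand
  side of the Bol form collapses to \<open>cy\<close>; multiplying by \<open>cx\<close> gives the
  Moufang identity.\<close>

lemma bol_imp_moufang:
  assumes [simp]: "c \<in> carrier Q"
    and bol: "\<And>y z. \<lbrakk>y \<in> carrier Q; z \<in> carrier Q\<rbrakk>
      \<Longrightarrow> (c \<otimes> (c \<otimes> y)) \<otimes> z = c \<otimes> (y \<otimes> (c \<otimes> z))"
  shows "c \<in> M\<^sub>0 Q"
  unfolding moufang_iff
proof (intro conjI ballI)
  fix x y assume [simp]: "x \<in> carrier Q" "y \<in> carrier Q"
  have "(c \<otimes> (c \<otimes> (x \<otimes> y))) \<otimes> inv (c \<otimes> x) = c \<otimes> ((x \<otimes> y) \<otimes> inv x)"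
    using bol[of "x \<otimes> y" "inv (c \<otimes> x)"] by (simp add: inv_mult)
  also have "\<dots> = c \<otimes> y" by (simp add: commutative[of "x \<otimes> y" "inv x"])
  finally have "(c \<otimes> x) \<otimes> ((c \<otimes> (c \<otimes> (x \<otimes> y))) \<otimes> inv (c \<otimes> x)) = (c \<otimes> x) \<otimes> (c \<otimes> y)"
    by simp
  then show "c \<otimes> (c \<otimes> (x \<otimes> y)) = (c \<otimes> x) \<otimes> (c \<otimes> y)"
    by (simp add: commutative[of "c \<otimes> (c \<otimes> (x \<otimes> y))" "inv (c \<otimes> x)"])
qed simp

lemma moufang_bol:
  assumes c: "c \<in> M\<^sub>0 Q" and [simp]: "y \<in> carrier Q" "z \<in> carrier Q"
  shows "(c \<otimes> (c \<otimes> y)) \<otimes> z = c \<otimes> (y \<otimes> (c \<otimes> z))"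
proof -
  have [simp]: "c \<in> carrier Q" using c by simp
  \<comment> \<open>Solves \<open>cx = inv z\<close>: the Moufang identity for
    \<open>y = x(y(inv x))\<close> then has \<open>inv z\<close> as a left factor, which moves to
    the other side, and \<open>inv x\<close> is \<open>cz\<close>.\<close>
  define x where "x = inv (c \<otimes> z)"
  have [simp]: "x \<in> carrier Q" by (simp add: x_def)
  have cx: "c \<otimes> x = inv z" by (simp add: x_def inv_mult)
  have "c \<otimes> (c \<otimes> y) = c \<otimes> (c \<otimes> (x \<otimes> (y \<otimes> inv x)))"
    by (simp add: commutative[of y])
  also have "\<dots> = inv z \<otimes> (c \<otimes> (y \<otimes> inv x))"
    using moufang[OF c, of x "y \<otimes> inv x"] cx by simp
  finally have "z \<otimes> (c \<otimes> (c \<otimes> y)) = c \<otimes> (y \<otimes> inv x)" by simp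
  then show ?thesis by (simp add: x_def commutative[of z])
qed

lemma moufang_square:
  assumes [simp]: "a \<in> carrier Q"
  shows "a \<otimes> a \<in> M\<^sub>0 Q"
proof (rule bol_imp_moufang)
  fix b w assume [simp]: "b \<in> carrier Q" "w \<in> carrier Q"
  \<comment> \<open>By the alternative law the first factor is the product of the squares of
    \<open>b\<close> and \<open>a\<close>. This rewrites the inner term of the ARIF identity at
    \<open>a \<otimes> a\<close>, \<open>b\<close>, \<open>inv b \<otimes> w\<close>.\<close>
  have "(b \<otimes> (b \<otimes> (a \<otimes> a))) \<otimes> (inv b \<otimes> w) = b \<otimes> ((a \<otimes> a) \<otimes> w)"
    using square_mult_left[of b a w] by (simp add: alternative[of b])
  then show "((a \<otimes> a) \<otimes> ((a \<otimes> a) \<otimes> b)) \<otimes> w = (a \<otimes> a) \<otimes> (b \<otimes> ((a \<otimes> a) \<otimes> w))"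
    using arif[of "a \<otimes> a" b "inv b \<otimes> w"] by simp
qed simp

section \<open>Closure of the Moufang elements under the loop operations\<close>

lemma moufang_one: "\<one> \<in> M\<^sub>0 Q"
  unfolding moufang_iff by simp

lemma moufang_inv:
  assumes c: "c \<in> M\<^sub>0 Q"
  shows "inv c \<in> M\<^sub>0 Q"
  unfolding moufang_iff
proof (intro conjI ballI)
  have [simp]: "c \<in> carrier Q" using c by simp
  show "inv c \<in> carrier Q" by simp
  fix x y assume [simp]: "x \<in> carrier Q" "y \<in> carrier Q"
  have "c \<otimes> (c \<otimes> ((inv c \<otimes> x) \<otimes> (inv c \<otimes> y))) = x \<otimes> y"
    by (simp add: moufang[OF c])
  then have "inv c \<otimes> (inv c \<otimes> (x \<otimes> y))
      = inv c \<otimes> (inv c \<otimes> (c \<otimes> (c \<otimes> ((inv c \<otimes> x) \<otimes> (inv c \<otimes> y)))))"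
    by simp
  then show "inv c \<otimes> (inv c \<otimes> (x \<otimes> y)) = (inv c \<otimes> x) \<otimes> (inv c \<otimes> y)"
    by simp
qed

text \<open>Two factorizations of \<open>L(cx)\<close>: \<open>L(c)^2 L(x) L(c)^-1\<close> from the
  Moufang identity and \<open>L(c)^-1 L(x) L(c)^2\<close> from its Bol form.\<close>

lemma moufang_mult_left:
  assumes c: "c \<in> M\<^sub>0 Q" and [simp]: "x \<in> carrier Q" "z \<in> carrier Q"
  shows moufang_mult_left1: "(c \<otimes> x) \<otimes> z = c \<otimes> (c \<otimes> (x \<otimes> (inv c \<otimes> z)))"
    and moufang_mult_left2: "(c \<otimes> x) \<otimes> z = inv c \<otimes> (x \<otimes> (c \<otimes> (c \<otimes> z)))"
proof -
  have [simp]: "c \<in> carrier Q" using c by simp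
  show "(c \<otimes> x) \<otimes> z = c \<otimes> (c \<otimes> (x \<otimes> (inv c \<otimes> z)))"
    by (simp add: moufang[OF c])
  have "x \<otimes> (c \<otimes> (c \<otimes> z)) = c \<otimes> ((c \<otimes> x) \<otimes> z)"
    using moufang_bol[OF c, of z x] by (simp add: commutative[of x] commutative[of "c \<otimes> x"])
  then show "(c \<otimes> x) \<otimes> z = inv c \<otimes> (x \<otimes> (c \<otimes> (c \<otimes> z)))" by simp
qed

lemma moufang_mult:
  assumes c: "c \<in> M\<^sub>0 Q" and d: "d \<in> M\<^sub>0 Q"
  shows "c \<otimes> d \<in> M\<^sub>0 Q"
  unfolding moufang_iff
proof (intro conjI ballI)
  have [simp]: "c \<in> carrier Q" "d \<in> carrier Q" using c d by simp_all
  show "c \<otimes> d \<in> carrier Q" by simp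
  fix x y assume [simp]: "x \<in> carrier Q" "y \<in> carrier Q"
  \<comment> \<open>Each factor gets a different factorization, so that the outer
    \<open>L(c)^2\<close> and \<open>L(c)^-1\<close> meet as the Bol form requires and leave a
    single \<open>c\<close> outside; then the Moufang identity of \<open>d\<close> applies.\<close>
  have "((c \<otimes> d) \<otimes> x) \<otimes> ((c \<otimes> d) \<otimes> y)
      = (c \<otimes> (c \<otimes> (d \<otimes> (inv c \<otimes> x)))) \<otimes> (inv c \<otimes> (d \<otimes> (c \<otimes> (c \<otimes> y))))"
    by (simp add: moufang_mult_left1[OF c, of d x] moufang_mult_left2[OF c, of d y])
  also have "\<dots> = c \<otimes> ((d \<otimes> (inv c \<otimes> x)) \<otimes> (d \<otimes> (c \<otimes> (c \<otimes> y))))"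
    by (simp add: moufang_bol[OF c])
  also have "\<dots> = c \<otimes> (d \<otimes> (d \<otimes> ((inv c \<otimes> x) \<otimes> (c \<otimes> (c \<otimes> y)))))"
    by (simp add: moufang[OF d])
  also have "(inv c \<otimes> x) \<otimes> (c \<otimes> (c \<otimes> y)) = c \<otimes> (x \<otimes> y)"
    using moufang_bol[OF c, of y "inv c \<otimes> x"] by (simp add: commutative[of "inv c \<otimes> x"] commutative[of y])
  finally show "(c \<otimes> d) \<otimes> ((c \<otimes> d) \<otimes> (x \<otimes> y)) = ((c \<otimes> d) \<otimes> x) \<otimes> ((c \<otimes> d) \<otimes> y)"
    by (simp add: rif_left)
qed

section \<open>Moving Moufang elements across a product\<close>

lemma moufang_cube_mult:
  assumes c: "c \<in> M\<^sub>0 Q" and [simp]: "x \<in> carrier Q"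
  shows "(c \<otimes> (c \<otimes> c)) \<otimes> x = c \<otimes> (c \<otimes> (c \<otimes> x))"
  using c by (simp add: moufang_mult_left1[OF c, of "c \<otimes> c"] alternative)

text \<open>Equating the two factorizations of \<open>L(cx)\<close> gives
  \<open>L(c)^3 L(x) = L(x) L(c)^3\<close>, and \<open>L(c)^3\<close> is the translation by the
  cube.\<close>

lemma moufang_cube_nuclear:
  assumes c: "c \<in> M\<^sub>0 Q" and [simp]: "x \<in> carrier Q" "y \<in> carrier Q"
  shows "(c \<otimes> (c \<otimes> c)) \<otimes> (x \<otimes> y) = x \<otimes> ((c \<otimes> (c \<otimes> c)) \<otimes> y)"
proof -
  have [simp]: "c \<in> carrier Q" using c by simp
  have "c \<otimes> (c \<otimes> (x \<otimes> y)) = inv c \<otimes> (x \<otimes> (c \<otimes> (c \<otimes> (c \<otimes> y))))"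
    using moufang_mult_left1[OF c, of x "c \<otimes> y"] moufang_mult_left2[OF c, of x "c \<otimes> y"] by simp
  then have "c \<otimes> (c \<otimes> (c \<otimes> (x \<otimes> y))) = x \<otimes> (c \<otimes> (c \<otimes> (c \<otimes> y)))" by simp
  then show ?thesis by (simp add: moufang_cube_mult[OF c])
qed

lemma square_shift:
  assumes [simp]: "x \<in> carrier Q" "y \<in> carrier Q" "r \<in> carrier Q"
  shows "\<exists>t \<in> carrier Q. x \<otimes> ((r \<otimes> r) \<otimes> y) = (t \<otimes> t) \<otimes> (x \<otimes> y)"
proof
  let ?v = "x \<otimes> (y \<otimes> r)"
  let ?t = "inv (x \<otimes> y) \<otimes> ?v"
  show "?t \<in> carrier Q" by simp
  \<comment> \<open>\<open>square_mult_left\<close> absorbs first \<open>y\<close> and then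
    \<open>x\<close> into the square, at the cost of \<open>inv (x \<otimes> y)\<close>; a last use,
    with \<open>inv (x \<otimes> y)\<close> absorbed, restores \<open>x \<otimes> y\<close>.\<close>
  have "(r \<otimes> r) \<otimes> y = ((y \<otimes> r) \<otimes> (y \<otimes> r)) \<otimes> inv y"
    using square_mult_left[of y r \<one>] by (simp add: square_mult[of y r] commutative[of "r \<otimes> r"])
  then have "x \<otimes> ((r \<otimes> r) \<otimes> y) = (?v \<otimes> ?v) \<otimes> inv (x \<otimes> y)"
    using square_mult_left[of x "y \<otimes> r" "inv y"]
    by (simp add: square_mult[of x "y \<otimes> r"] inv_mult)
  also have "\<dots> = (?t \<otimes> ?t) \<otimes> (x \<otimes> y)"
    using square_mult_left[of "inv (x \<otimes> y)" ?v \<one>]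
    by (simp add: square_mult[of "inv (x \<otimes> y)" ?v] commutative[of "inv (x \<otimes> y)" "?v \<otimes> ?v"])
  finally show "x \<otimes> ((r \<otimes> r) \<otimes> y) = (?t \<otimes> ?t) \<otimes> (x \<otimes> y)" .
qed

lemma moufang_shift:
  assumes c: "c \<in> M\<^sub>0 Q" and [simp]: "x \<in> carrier Q" "y \<in> carrier Q"
  shows "\<exists>d \<in> M\<^sub>0 Q. x \<otimes> (c \<otimes> y) = d \<otimes> (x \<otimes> y)"
proof -
  have [simp]: "c \<in> carrier Q" using c by simp
  \<comment> \<open>\<open>L(c)\<close> is \<open>L(?n) L(?r)^2\<close>: the cube commutes with
    \<open>L(x)\<close>, the square is shifted to \<open>t \<otimes> t\<close>, and \<open>d\<close>
    is their product.\<close>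
  let ?n = "c \<otimes> (c \<otimes> c)" and ?r = "inv c"
  obtain t where [simp]: "t \<in> carrier Q"
    and t: "x \<otimes> ((?r \<otimes> ?r) \<otimes> y) = (t \<otimes> t) \<otimes> (x \<otimes> y)"
    using square_shift[of x y ?r] by auto
  have "x \<otimes> (c \<otimes> y) = x \<otimes> (?n \<otimes> ((?r \<otimes> ?r) \<otimes> y))"
    by (simp add: moufang_cube_mult[OF c] alternative)
  also have "\<dots> = ?n \<otimes> ((t \<otimes> t) \<otimes> (x \<otimes> y))"
    by (simp flip: moufang_cube_nuclear[OF c] t)
  also have "\<dots> = (?n \<otimes> (t \<otimes> t)) \<otimes> (x \<otimes> y)"
    using moufang_cube_nuclear[OF c, of "x \<otimes> y" "t \<otimes> t"]
    by (simp add: commutative[of "x \<otimes> y"])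
  finally show ?thesis using c by (blast intro: moufang_mult moufang_square \<open>t \<in> carrier Q\<close>)
qed

text \<open>The shift for \<open>inv x\<close> and \<open>x \<otimes> y\<close>, multiplied by
  \<open>x\<close>.\<close>

lemma moufang_unshift:
  assumes c: "c \<in> M\<^sub>0 Q" and [simp]: "x \<in> carrier Q" "y \<in> carrier Q"
  shows "\<exists>d \<in> M\<^sub>0 Q. c \<otimes> (x \<otimes> y) = x \<otimes> (d \<otimes> y)"
proof -
  obtain d where d: "d \<in> M\<^sub>0 Q" "inv x \<otimes> (c \<otimes> (x \<otimes> y)) = d \<otimes> (inv x \<otimes> (x \<otimes> y))"
    using moufang_shift[OF c, of "inv x" "x \<otimes> y"] by auto
  then have "x \<otimes> (inv x \<otimes> (c \<otimes> (x \<otimes> y))) = x \<otimes> (d \<otimes> y)" by simp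
  then have "c \<otimes> (x \<otimes> y) = x \<otimes> (d \<otimes> y)" using c by simp
  then show ?thesis using d(1) by blast
qed

text \<open>Commutativity puts \<open>d\<close> innermost, unshifting by \<open>x\<close> brings the
  Moufang factor next to it, and the two fuse to one Moufang element.\<close>

lemma moufang_assoc:
  assumes c: "c \<in> M\<^sub>0 Q" and d: "d \<in> M\<^sub>0 Q" and [simp]: "x \<in> carrier Q"
  shows "\<exists>e \<in> M\<^sub>0 Q. c \<otimes> (d \<otimes> x) = e \<otimes> x"
proof -
  obtain e where "e \<in> M\<^sub>0 Q" "c \<otimes> (x \<otimes> d) = x \<otimes> (e \<otimes> d)"
    using moufang_unshift[OF c, of x d] d by auto
  then show ?thesis
    using d moufang_mult by (intro bexI[of _ "e \<otimes> d"]) (auto simp: commutative[of x])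
qed

section \<open>Cosets of the Moufang elements\<close>

lemma mem_moufang_coset: "y \<in> M\<^sub>0 Q #> x \<longleftrightarrow> (\<exists>c \<in> M\<^sub>0 Q. y = c \<otimes> x)"
  by (auto simp: r_coset_def)

lemma moufang_coset_one: "M\<^sub>0 Q #> \<one> = M\<^sub>0 Q"
  by (auto simp: mem_moufang_coset)

lemma moufang_coset_self: "x \<in> carrier Q \<Longrightarrow> x \<in> M\<^sub>0 Q #> x"
  using moufang_one by (force simp: mem_moufang_coset)

lemma moufang_coset_absorb:
  assumes c: "c \<in> M\<^sub>0 Q" and [simp]: "x \<in> carrier Q"
  shows "M\<^sub>0 Q #> (c \<otimes> x) = M\<^sub>0 Q #> x"
proof (intro equalityI subsetI)
  fix y assume "y \<in> M\<^sub>0 Q #> (c \<otimes> x)"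
  then show "y \<in> M\<^sub>0 Q #> x" using moufang_assoc[OF _ c] by (force simp: mem_moufang_coset)
next
  fix y assume "y \<in> M\<^sub>0 Q #> x"
  then obtain d where d: "d \<in> M\<^sub>0 Q" "y = d \<otimes> x" by (auto simp: mem_moufang_coset)
  \<comment> \<open>The reverse inclusion absorbs \<open>inv c\<close>, which is again
    Moufang.\<close>
  have "d \<otimes> x = d \<otimes> (inv c \<otimes> (c \<otimes> x))" using c by simp
  then show "y \<in> M\<^sub>0 Q #> (c \<otimes> x)"
    using d c moufang_assoc[OF d(1) moufang_inv[OF c], of "c \<otimes> x"]
    by (auto simp: mem_moufang_coset)
qed

text \<open>Shifting pulls the Moufang factors of both representatives to the front, where they
  fuse; conversely, unshifting pushes a front factor onto \<open>y\<close>, with \<open>x\<close>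
  representing its own coset.\<close>

lemma moufang_coset_mult:
  assumes [simp]: "x \<in> carrier Q" "y \<in> carrier Q"
  shows "(M\<^sub>0 Q #> x) <#> (M\<^sub>0 Q #> y) = M\<^sub>0 Q #> (x \<otimes> y)"
proof (intro equalityI subsetI)
  fix z assume "z \<in> (M\<^sub>0 Q #> x) <#> (M\<^sub>0 Q #> y)"
  then obtain c d where cd: "c \<in> M\<^sub>0 Q" "d \<in> M\<^sub>0 Q" "z = (c \<otimes> x) \<otimes> (d \<otimes> y)"
    by (auto simp: set_mult_def mem_moufang_coset)
  obtain e where e: "e \<in> M\<^sub>0 Q" "z = e \<otimes> ((c \<otimes> x) \<otimes> y)"
    using moufang_shift[OF cd(2), of "c \<otimes> x" y] cd by auto
  obtain f where f: "f \<in> M\<^sub>0 Q" "(c \<otimes> x) \<otimes> y = f \<otimes> (x \<otimes> y)"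
    using moufang_shift[OF cd(1), of y x] cd(1) by (auto simp: commutative[of y])
  show "z \<in> M\<^sub>0 Q #> (x \<otimes> y)"
    using moufang_assoc[OF e(1) f(1), of "x \<otimes> y"] e f by (simp add: mem_moufang_coset)
next
  fix z assume "z \<in> M\<^sub>0 Q #> (x \<otimes> y)"
  then obtain c where c: "c \<in> M\<^sub>0 Q" "z = c \<otimes> (x \<otimes> y)" by (auto simp: mem_moufang_coset)
  then obtain d where "d \<in> M\<^sub>0 Q" "z = x \<otimes> (d \<otimes> y)"
    using moufang_unshift[OF c(1), of x y] by auto
  then show "z \<in> (M\<^sub>0 Q #> x) <#> (M\<^sub>0 Q #> y)"
    using moufang_coset_self[of x] mem_moufang_coset[of "d \<otimes> y" y]
    unfolding set_mult_def by auto
qed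

end

section \<open>The quotient as a Steiner loop\<close>

lemma steiner_loopI:
  fixes H (structure)
  assumes closed: "\<And>x y. \<lbrakk>x \<in> carrier H; y \<in> carrier H\<rbrakk> \<Longrightarrow> x \<otimes> y \<in> carrier H"
    and one: "\<one> \<in> carrier H"
    and left: "\<And>x. x \<in> carrier H \<Longrightarrow> \<one> \<otimes> x = x"
    and comm: "\<And>x y. \<lbrakk>x \<in> carrier H; y \<in> carrier H\<rbrakk> \<Longrightarrow> x \<otimes> y = y \<otimes> x"
    and key: "\<And>x y. \<lbrakk>x \<in> carrier H; y \<in> carrier H\<rbrakk> \<Longrightarrow> x \<otimes> (x \<otimes> y) = y"
  shows "steiner_loop H" and "c_loop H"
proof -
  have right: "x \<otimes> \<one> = x" if "x \<in> carrier H" for x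
    using that left comm one by simp
  have sq: "x \<otimes> x = \<one>" if "x \<in> carrier H" for x
    using key[OF that one] right[OF that] by simp
  have key': "(y \<otimes> x) \<otimes> x = y" if "x \<in> carrier H" "y \<in> carrier H" for x y
    using that key comm closed by simp
  \<comment> \<open>Each translation is its own inverse by \<open>key\<close> and
    \<open>key'\<close>, so \<open>a \<otimes> b\<close> solves \<open>ax = b\<close> and
    \<open>b \<otimes> a\<close> solves \<open>ya = b\<close>.\<close>
  interpret loop H
    by unfold_locales (use closed one left right key key' in \<open>metis\<close>)+
  have "ip_loop H"
  proof
    fix x assume "x \<in> carrier H"
    then show "\<exists>x' \<in> carrier H. x \<otimes> x' = \<one> \<and> x' \<otimes> x = \<one> \<and>
        (\<forall>y \<in> carrier H. x' \<otimes> (x \<otimes> y) = y \<and> (y \<otimes> x) \<otimes> x' = y)"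
      using key key' sq by blast
  qed
  moreover have "has_exponent H 2"
    by (simp add: has_exponent_def numeral_2_eq_2 nat_pow_def left sq)
  ultimately show "steiner_loop H" by (simp add: steiner_loop_def)
  \<comment> \<open>Both sides of the C identity reduce to \<open>x \<otimes> z\<close>.\<close>
  show "c_loop H"
    by unfold_locales (simp add: closed key key')
qed

context comm_rif_loop
begin

lemma steiner_Mod_moufang:
  shows "steiner_loop (Q Mod M\<^sub>0 Q)" and "c_loop (Q Mod M\<^sub>0 Q)"
proof -
  have rep: "\<exists>x \<in> carrier Q. A = M\<^sub>0 Q #> x" if "A \<in> carrier (Q Mod M\<^sub>0 Q)" for A
    using that by (auto simp: FactGroup_def RCOSETS_def)
  have coset: "M\<^sub>0 Q #> x \<in> carrier (Q Mod M\<^sub>0 Q)" if "x \<in> carrier Q" for x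
    using that by (auto simp: FactGroup_def RCOSETS_def)
  have mult: "(M\<^sub>0 Q #> x) \<otimes>\<^bsub>Q Mod M\<^sub>0 Q\<^esub> (M\<^sub>0 Q #> y) = M\<^sub>0 Q #> (x \<otimes> y)"
    if "x \<in> carrier Q" "y \<in> carrier Q" for x y
    using moufang_coset_mult[OF that] by (simp add: FactGroup_def)
  have one: "\<one>\<^bsub>Q Mod M\<^sub>0 Q\<^esub> = M\<^sub>0 Q #> \<one>"
    by (simp add: FactGroup_def moufang_coset_one)
  have closed': "A \<otimes>\<^bsub>Q Mod M\<^sub>0 Q\<^esub> B \<in> carrier (Q Mod M\<^sub>0 Q)"
    if "A \<in> carrier (Q Mod M\<^sub>0 Q)" "B \<in> carrier (Q Mod M\<^sub>0 Q)" for A B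
    using rep[OF that(1)] rep[OF that(2)] by (metis mult coset mult_closed)
  have comm: "A \<otimes>\<^bsub>Q Mod M\<^sub>0 Q\<^esub> B = B \<otimes>\<^bsub>Q Mod M\<^sub>0 Q\<^esub> A"
    if "A \<in> carrier (Q Mod M\<^sub>0 Q)" "B \<in> carrier (Q Mod M\<^sub>0 Q)" for A B
    using rep[OF that(1)] rep[OF that(2)] by (metis mult commutative)
  have left: "\<one>\<^bsub>Q Mod M\<^sub>0 Q\<^esub> \<otimes>\<^bsub>Q Mod M\<^sub>0 Q\<^esub> A = A" if "A \<in> carrier (Q Mod M\<^sub>0 Q)" for A
    using rep[OF that] by (metis one mult one_left one_closed)
  \<comment> \<open>The square of a representative is Moufang and is absorbed by the coset.
    Divisibility in the quotient will follow from this law.\<close>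
  have key: "A \<otimes>\<^bsub>Q Mod M\<^sub>0 Q\<^esub> (A \<otimes>\<^bsub>Q Mod M\<^sub>0 Q\<^esub> B) = B"
    if AB: "A \<in> carrier (Q Mod M\<^sub>0 Q)" "B \<in> carrier (Q Mod M\<^sub>0 Q)" for A B
  proof -
    obtain x y where xy: "x \<in> carrier Q" "y \<in> carrier Q" "A = M\<^sub>0 Q #> x" "B = M\<^sub>0 Q #> y"
      using rep[OF AB(1)] rep[OF AB(2)] by blast
    then have "A \<otimes>\<^bsub>Q Mod M\<^sub>0 Q\<^esub> (A \<otimes>\<^bsub>Q Mod M\<^sub>0 Q\<^esub> B) = M\<^sub>0 Q #> ((x \<otimes> x) \<otimes> y)"
      by (simp only: mult mult_closed alternative)
    then show ?thesis using xy by (simp only: moufang_coset_absorb moufang_square)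
  qed
  have one': "\<one>\<^bsub>Q Mod M\<^sub>0 Q\<^esub> \<in> carrier (Q Mod M\<^sub>0 Q)" unfolding one by (rule coset) simp
  show "steiner_loop (Q Mod M\<^sub>0 Q)" "c_loop (Q Mod M\<^sub>0 Q)"
    using steiner_loopI[OF closed' one' left comm key] by blast+
qed

lemma normal_subloop_moufang: "normal_subloop (M\<^sub>0 Q) Q"
proof -
  have hom: "(\<lambda>x. M\<^sub>0 Q #> x) \<in> hom Q (Q Mod M\<^sub>0 Q)"
    using moufang_coset_mult by (auto simp: hom_def FactGroup_def RCOSETS_def)
  \<comment> \<open>\<open>M\<^sub>0 Q\<close> is the neutral coset, so this identifies the kernel
    of the coset map; that \<open>M\<^sub>0 Q\<close> is a subloop then comes with being a
    kernel.\<close>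
  have "M\<^sub>0 Q #> x = M\<^sub>0 Q \<longleftrightarrow> x \<in> M\<^sub>0 Q" if "x \<in> carrier Q" for x
    using that moufang_coset_self[OF that] moufang_coset_absorb[of x \<one>]
    by (auto simp: moufang_coset_one)
  then have "{x \<in> carrier Q. M\<^sub>0 Q #> x = M\<^sub>0 Q} = M\<^sub>0 Q"
    using moufang_closed by blast
  then have "kernel Q (Q Mod M\<^sub>0 Q) (\<lambda>x. M\<^sub>0 Q #> x) = M\<^sub>0 Q"
    by (simp add: kernel_def FactGroup_def)
  moreover have "loop (Q Mod M\<^sub>0 Q)"
    using steiner_Mod_moufang(2) by (rule c_loop.axioms)
  ultimately show ?thesis
    using normal_subloop_kernel[OF loop_axioms _ hom] by simp
qed

end

theorem theorem4p5:
  fixes Q :: "('a, 'b) monoid_scheme" (structure)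
  assumes "comm_rif_loop Q"
  shows "(\<forall>x \<in> carrier Q. x [^] (2::nat) \<in> M\<^sub>0 Q) \<and>
    normal_subloop (M\<^sub>0 Q) Q \<and>
    (c_loop (Q Mod M\<^sub>0 Q) \<and> has_exponent (Q Mod M\<^sub>0 Q) 2 \<and> steiner_loop (Q Mod M\<^sub>0 Q))"
proof -
  interpret comm_rif_loop Q by fact
  have "x [^] (2::nat) = x \<otimes> x" if "x \<in> carrier Q" for x
    using that by (simp add: numeral_2_eq_2 nat_pow_def)
  then show ?thesis
    using moufang_square normal_subloop_moufang steiner_Mod_moufang
    by (simp add: steiner_loop_def)
qed

end
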